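(* Let $G$ be a subcubic graph with $\mathrm{mad}(G)<\frac{12}{5}$. Then $\chi_{DP}(G^2)\le 6$.
   Context: All graphs are finite and simple. A graph $G$ is subcubic if its maximum degree is at most $3$. The square $G^2$ is the graph obtained from $G$ by adding an edge between every pair of vertices at distance $2$ in $G$. The maximum average degree is $\mathrm{mad}(G)=\max_{H\subseteq G}\frac{2|E(H)|}{|V(H)|}$, over (nonempty) subgraphs $H$ of $G$. DP-coloring. Let $G=(V,E)$ be a graph and $L$ a list assignment (a set $L(u)$ of colors for each $u\in V$). A cover $H_L$ of $G$ is a graph such that: (1) $V(H_L)=\{(u,c):u\in V,\ c\in L(u)\}$; (2) for each $u$, the set $\{u\}\times L(u)$ induces a clique; (3) for each edge $uv\in E$, the edges of $H_L$ between $\{u\}\times L(u)$ and $\{v\}\times L(v)$ form a (possibly empty) matching $M_{uv}$; (4) for distinct $u,v$ with $uv\notin E$, there are no edges of $H_L$ between $\{u\}\times L(u)$ and $\{v\}\times L(v)$. The graph $G$ is DP-$k$-colorable if for every list assignment $L$ with $|L(u)|\ge k$ for all $u\in V$, every cover $H_L$ (i.e. every choice of matchings) contains an independent set $I$ with $|I|=|V|$. The DP-chromatic number $\chi_{DP}(G)$ is the minimum $k$ such that $G$ is DP-$k$-colorable. *)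

theory Defs
  imports Complex_Main "HOL-Library.Extended_Nat"
begin

section \<open>Finite simple graphs\<close>

record 'a sgraph =
  vertices :: "'a set"
  edges :: "'a set set"

definition simple_graph :: "'a sgraph \<Rightarrow> bool" where
  "simple_graph G \<longleftrightarrow>
     finite (vertices G) \<and> (\<forall>e\<in>edges G. e \<subseteq> vertices G \<and> card e = 2)"

definition adjacent :: "'a sgraph \<Rightarrow> 'a \<Rightarrow> 'a \<Rightarrow> bool" where
  "adjacent G u v \<longleftrightarrow> {u, v} \<in> edges G"

definition degree :: "'a sgraph \<Rightarrow> 'a \<Rightarrow> nat" where
  "degree G v = card {u \<in> vertices G. adjacent G v u}"

text \<open>The inserted \<open>0\<close>, here and in \<open>mad\<close>, matters only for the graph without vertices.\<close>

definition max_degree :: "'a sgraph \<Rightarrow> nat" where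
  "max_degree G = Max (insert 0 (degree G ` vertices G))"

definition subcubic :: "'a sgraph \<Rightarrow> bool" where
  "subcubic G \<longleftrightarrow> max_degree G \<le> 3"

definition subgraph :: "'a sgraph \<Rightarrow> 'a sgraph \<Rightarrow> bool" where
  "subgraph H G \<longleftrightarrow>
     simple_graph H \<and> vertices H \<subseteq> vertices G \<and> edges H \<subseteq> edges G"

definition mad :: "'a sgraph \<Rightarrow> real" where
  "mad G = Max (insert 0
     {2 * real (card (edges H)) / real (card (vertices H)) | H.
        subgraph H G \<and> vertices H \<noteq> {}})"

definition walk :: "'a sgraph \<Rightarrow> 'a \<Rightarrow> 'a list \<Rightarrow> 'a \<Rightarrow> bool" where
  "walk G u p v \<longleftrightarrow>
     p \<noteq> [] \<and> set p \<subseteq> vertices G \<and> successively (adjacent G) p \<and> hd p = u \<and> last p = v"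

text \<open>The distance is \<open>\<infinity>\<close> between vertices of different components.\<close>

definition distance :: "'a sgraph \<Rightarrow> 'a \<Rightarrow> 'a \<Rightarrow> enat" where
  "distance G u v = (INF p \<in> {p. walk G u p v}. enat (length p - 1))"

definition square :: "'a sgraph \<Rightarrow> 'a sgraph" where
  "square G =
     \<lparr>vertices = vertices G,
      edges = edges G \<union>
        {{u, v} | u v. u \<in> vertices G \<and> v \<in> vertices G \<and> distance G u v = 2}\<rparr>"

definition independent_set :: "'a sgraph \<Rightarrow> 'a set \<Rightarrow> bool" where
  "independent_set G I \<longleftrightarrow>
     I \<subseteq> vertices G \<and> (\<forall>x\<in>I. \<forall>y\<in>I. \<not> adjacent G x y)"

definition matching :: "'a set set \<Rightarrow> bool" where
  "matching M \<longleftrightarrow> (\<forall>e\<in>M. \<forall>f\<in>M. e \<noteq> f \<longrightarrow> e \<inter> f = {})"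


section \<open>DP-coloring\<close>

definition edges_between :: "'a sgraph \<Rightarrow> 'a set \<Rightarrow> 'a set \<Rightarrow> 'a set set" where
  "edges_between G A B = {{x, y} | x y. x \<in> A \<and> y \<in> B \<and> {x, y} \<in> edges G}"

definition cover :: "'a sgraph \<Rightarrow> ('a \<Rightarrow> 'c set) \<Rightarrow> ('a \<times> 'c) sgraph \<Rightarrow> bool" where
  "cover G L H \<longleftrightarrow>
     simple_graph H \<and>
     vertices H = (SIGMA u:vertices G. L u) \<and>
     (\<forall>u\<in>vertices G. \<forall>x\<in>{u} \<times> L u. \<forall>y\<in>{u} \<times> L u. x \<noteq> y \<longrightarrow> adjacent H x y) \<and>
     (\<forall>u\<in>vertices G. \<forall>v\<in>vertices G. adjacent G u v \<longrightarrow>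
        matching (edges_between H ({u} \<times> L u) ({v} \<times> L v))) \<and>
     (\<forall>u\<in>vertices G. \<forall>v\<in>vertices G. u \<noteq> v \<and> \<not> adjacent G u v \<longrightarrow>
        edges_between H ({u} \<times> L u) ({v} \<times> L v) = {})"

text \<open>Since a cover is a finite graph, a list assignment that has a cover consists of finite
  lists. Hence \<open>card\<close> is the true cardinality, and natural numbers suffice as colors.\<close>

definition DP_colorable :: "nat \<Rightarrow> 'a sgraph \<Rightarrow> bool" where
  "DP_colorable k G \<longleftrightarrow>
     (\<forall>(L :: 'a \<Rightarrow> nat set) H.
        (\<forall>u\<in>vertices G. card (L u) \<ge> k) \<and> cover G L H \<longrightarrow>
        (\<exists>I. independent_set H I \<and> card I = card (vertices G)))"

definition DP_chromatic_number :: "'a sgraph \<Rightarrow> nat" where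
  "DP_chromatic_number G = (LEAST k. DP_colorable k G)"

end

theory Submission
  imports Defs
begin

text \<open>
  Greedy colouring in a suitable order proves the theorem. In a subcubic graph the number of
  vertices within distance 2 of \<open>v\<close> is at most the sum of the degrees of the neighbours of \<open>v\<close>.
  This sum is at most 5 if \<open>v\<close> has degree at most 1, and also if \<open>v\<close> has degree 2 and a neighbour
  of degree 2. Each coloured vertex near \<open>v\<close> forbids at most one colour at \<open>v\<close>, because the
  cover is a matching there, so such a vertex can always be coloured last from 6 colours.

  Deleting a vertex may destroy a path of length 2 between two remaining vertices, and then a
  colouring of the smaller graph does not respect all constraints of the larger one. Hence the
  set \<open>S\<close> that is deleted must be such that each of its vertices has at most one neighbour
  outside \<open>S\<close>. A single vertex of degree at most 1, or two adjacent vertices of degree 2, form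
  such a set (\<open>exists_reducible_set\<close>).

  The bound on the maximum average degree guarantees that one of these exists. Otherwise all degrees
  are 2 or 3 and no two vertices of degree 2 are adjacent. Counting the edges between the
  \<open>a\<close> vertices of degree 2 and the \<open>b\<close> vertices of degree 3 gives \<open>2 a \<le> 3 b\<close>, which says exactly
  that the average degree \<open>(2 a + 3 b) / (a + b)\<close> is at least \<open>12 / 5\<close>. Both hypotheses pass to
  subgraphs, so induction on the number of vertices finishes the proof (\<open>conflict_free_colouring\<close>).
\<close>

section \<open>Degrees and average degree\<close>

definition neighbours :: "'a sgraph \<Rightarrow> 'a \<Rightarrow> 'a set" where
  "neighbours G v = {u \<in> vertices G. adjacent G v u}"

lemma degree_eq_card_neighbours: "degree G v = card (neighbours G v)"
  by (simp add: degree_def neighbours_def)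

lemma adjacent_sym: "adjacent G u v \<Longrightarrow> adjacent G v u"
  by (simp add: adjacent_def insert_commute)

lemma adjacent_in_vertices:
  assumes "simple_graph G" "adjacent G u v"
  shows "u \<in> vertices G" "v \<in> vertices G" "u \<noteq> v"
proof -
  have "{u, v} \<subseteq> vertices G" "card {u, v} = 2"
    using assms unfolding simple_graph_def adjacent_def by blast+
  then show "u \<in> vertices G" "v \<in> vertices G" "u \<noteq> v" by auto
qed

lemma finite_neighbours: "simple_graph G \<Longrightarrow> finite (neighbours G v)"
  by (simp add: simple_graph_def neighbours_def)

lemma finite_edges: "simple_graph G \<Longrightarrow> finite (edges G)"
  by (rule finite_subset[of _ "Pow (vertices G)"]) (auto simp: simple_graph_def)

lemma handshake:
  assumes G: "simple_graph G"
  shows "(\<Sum>v\<in>vertices G. degree G v) = 2 * card (edges G)"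
proof -
  have "degree G v = card {e \<in> edges G. v \<in> e}" if "v \<in> vertices G" for v
  proof -
    have "bij_betw (\<lambda>u. {v, u}) (neighbours G v) {e \<in> edges G. v \<in> e}"
    proof (rule bij_betw_imageI)
      show "inj_on (\<lambda>u. {v, u}) (neighbours G v)"
        by (auto simp: inj_on_def doubleton_eq_iff)
      show "(\<lambda>u. {v, u}) ` neighbours G v = {e \<in> edges G. v \<in> e}"
      proof (intro equalityI subsetI)
        fix e assume e: "e \<in> {e \<in> edges G. v \<in> e}"
        then have "card e = 2" "e \<subseteq> vertices G"
          using G by (auto simp: simple_graph_def)
        then obtain x y where "e = {x, y}" by (auto simp: card_2_iff)
        then obtain u where "e = {v, u}" using e by auto
        then show "e \<in> (\<lambda>u. {v, u}) ` neighbours G v"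
          using e \<open>e \<subseteq> vertices G\<close> by (auto simp: neighbours_def adjacent_def)
      qed (auto simp: neighbours_def adjacent_def)
    qed
    then show ?thesis
      by (simp add: degree_eq_card_neighbours bij_betw_same_card)
  qed
  then have "(\<Sum>v\<in>vertices G. degree G v) = (\<Sum>v\<in>vertices G. card {e \<in> edges G. v \<in> e})"
    by simp
  also have "\<dots> = 2 * card (edges G)"
  proof (rule sum_multicount)
    show "\<forall>e\<in>edges G. card {v \<in> vertices G. v \<in> e} = 2"
    proof
      fix e assume "e \<in> edges G"
      then have "e \<subseteq> vertices G" "card e = 2" using G by (auto simp: simple_graph_def)
      then have "{v \<in> vertices G. v \<in> e} = e" by auto
      then show "card {v \<in> vertices G. v \<in> e} = 2" using \<open>card e = 2\<close> by simp
    qed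
  qed (use G finite_edges[OF G] in \<open>auto simp: simple_graph_def\<close>)
  finally show ?thesis .
qed

lemma finite_subgraph_densities:
  assumes G: "simple_graph G"
  shows "finite {2 * real (card (edges H)) / real (card (vertices H)) | H.
    subgraph H G \<and> vertices H \<noteq> {}}" (is "finite ?D")
proof (rule finite_subset)
  show "?D \<subseteq> (\<lambda>(W, F). 2 * real (card F) / real (card W)) ` (Pow (vertices G) \<times> Pow (edges G))"
    by (force simp: subgraph_def)
  show "finite ((\<lambda>(W, F). 2 * real (card F) / real (card W)) ` (Pow (vertices G) \<times> Pow (edges G)))"
    using G finite_edges[OF G] by (auto simp: simple_graph_def)
qed

lemma mad_subgraph_mono:
  assumes "simple_graph G" "subgraph H G"
  shows "mad H \<le> mad G"
proof -
  have "subgraph K G" if "subgraph K H" for K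
    using that assms by (auto simp: subgraph_def)
  then show ?thesis
    unfolding mad_def
    by (intro Max_mono) (use finite_subgraph_densities[OF assms(1)] in blast)+
qed

lemma average_degree_le_mad:
  assumes "simple_graph G" "vertices G \<noteq> {}"
  shows "2 * real (card (edges G)) / real (card (vertices G)) \<le> mad G"
  unfolding mad_def
proof (rule Max_ge)
  have "subgraph G G" using assms by (simp add: subgraph_def)
  then show "2 * real (card (edges G)) / real (card (vertices G)) \<in> insert 0
     {2 * real (card (edges H)) / real (card (vertices H)) | H.
        subgraph H G \<and> vertices H \<noteq> {}}"
    using assms by blast
  show "finite (insert 0 {2 * real (card (edges H)) / real (card (vertices H)) | H.
        subgraph H G \<and> vertices H \<noteq> {}})"
    using finite_subgraph_densities[OF assms(1)] by (rule finite.insertI)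
qed

lemma subcubic_iff:
  assumes "simple_graph G"
  shows "subcubic G \<longleftrightarrow> (\<forall>v\<in>vertices G. degree G v \<le> 3)"
  using assms by (auto simp: subcubic_def max_degree_def simple_graph_def)

lemma degree_subgraph_le:
  assumes "simple_graph G" "subgraph H G"
  shows "degree H v \<le> degree G v"
  unfolding degree_eq_card_neighbours
proof (rule card_mono)
  show "neighbours H v \<subseteq> neighbours G v"
    using assms by (auto simp: subgraph_def neighbours_def adjacent_def)
qed (rule finite_neighbours[OF assms(1)])

section \<open>A reducible set of vertices\<close>

text \<open>The double count of the edges between vertices of degree 2 and vertices of degree 3. The
  value \<open>12 / 5\<close> is attained when every edge joins a vertex of degree 2 to one of degree 3.\<close>

lemma mad_ge_if_no_adjacent_degree_2:
  assumes G: "simple_graph G" and ne: "vertices G \<noteq> {}"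
    and deg: "\<And>v. v \<in> vertices G \<Longrightarrow> degree G v = 2 \<or> degree G v = 3"
    and indep: "\<And>u v. adjacent G u v \<Longrightarrow> degree G u = 2 \<Longrightarrow> degree G v \<noteq> 2"
  shows "mad G \<ge> 12 / 5"
proof -
  define A where "A = {v \<in> vertices G. degree G v = 2}"
  define B where "B = {v \<in> vertices G. degree G v = 3}"
  have fin: "finite A" "finite B" "finite (vertices G)"
    using G by (auto simp: A_def B_def simple_graph_def)
  have V: "vertices G = A \<union> B" and disj: "A \<inter> B = {}"
    using deg by (auto simp: A_def B_def)
  have "2 * card A = (\<Sum>u\<in>A. card {x \<in> B. adjacent G u x})"
  proof -
    have "card {x \<in> B. adjacent G u x} = 2" if "u \<in> A" for u
    proof -
      have "{x \<in> B. adjacent G u x} = neighbours G u"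
        using that deg indep by (fastforce simp: neighbours_def A_def B_def)
      then show ?thesis using that by (simp add: A_def degree_eq_card_neighbours)
    qed
    then show ?thesis by simp
  qed
  also have "\<dots> = (\<Sum>x\<in>B. card {u \<in> A. adjacent G u x})"
    by (rule sum_multicount_gen) (use fin in auto)
  also have "\<dots> \<le> (\<Sum>x\<in>B. 3)"
  proof (rule sum_mono)
    fix x assume x: "x \<in> B"
    have "card {u \<in> A. adjacent G u x} \<le> card (neighbours G x)"
      by (intro card_mono)
        (auto simp: fin neighbours_def A_def intro: adjacent_sym)
    then show "card {u \<in> A. adjacent G u x} \<le> 3"
      using x by (simp add: B_def degree_eq_card_neighbours)
  qed
  finally have count: "2 * card A \<le> 3 * card B" by simp
  have "2 * card (edges G) = (\<Sum>v\<in>A. degree G v) + (\<Sum>v\<in>B. degree G v)"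
    using handshake[OF G] fin disj by (simp add: V sum.union_disjoint)
  also have "\<dots> = 2 * card A + 3 * card B" by (simp add: A_def B_def)
  finally have E: "2 * card (edges G) = 2 * card A + 3 * card B" .
  have "card (vertices G) = card A + card B"
    using fin disj by (simp add: V card_Un_disjoint)
  then have "12 * card (vertices G) \<le> 5 * (2 * card (edges G))"
    using E count by simp
  moreover have "card (vertices G) > 0" using ne fin by (simp add: card_gt_0_iff)
  ultimately have "12 / 5 \<le> 2 * real (card (edges G)) / real (card (vertices G))"
    by (simp add: field_simps)
  then show ?thesis using average_degree_le_mad[OF G ne] by linarith
qed

text \<open>The first conclusion on \<open>S\<close> keeps the pairs at distance at most 2 outside \<open>S\<close> unchanged when
  \<open>S\<close> is deleted; the second one bounds the number of vertices near each vertex of \<open>S\<close>.\<close>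

lemma exists_reducible_set:
  assumes G: "simple_graph G" and ne: "vertices G \<noteq> {}" and cubic: "subcubic G"
    and mad: "mad G < 12 / 5"
  obtains S where "S \<subseteq> vertices G" "S \<noteq> {}"
    and "\<And>v. v \<in> S \<Longrightarrow> card (neighbours G v - S) \<le> 1"
    and "\<And>v. v \<in> S \<Longrightarrow> (\<Sum>x\<in>neighbours G v. degree G x) \<le> 5"
proof -
  have le3: "degree G v \<le> 3" if "v \<in> vertices G" for v
    using cubic that by (simp add: subcubic_iff G)
  consider (leaf) v where "v \<in> vertices G" "degree G v \<le> 1"
    | (pair) u v where "adjacent G u v" "degree G u = 2" "degree G v = 2"
  proof (cases "\<exists>v\<in>vertices G. degree G v \<le> 1")
    case False
    have "degree G v = 2 \<or> degree G v = 3" if "v \<in> vertices G" for v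
      using le3[OF that] False that by force
    then show ?thesis
      using mad_ge_if_no_adjacent_degree_2[OF G ne] mad pair by fastforce
  qed (use leaf in blast)
  then show thesis
  proof cases
    case leaf
    have "(\<Sum>x\<in>neighbours G v. degree G x) \<le> card (neighbours G v) * 3"
      using sum_bounded_above[of "neighbours G v" "degree G" 3] le3
      by (simp add: neighbours_def)
    also have "\<dots> \<le> 5" using leaf by (simp add: degree_eq_card_neighbours)
    finally have "(\<Sum>x\<in>neighbours G v. degree G x) \<le> 5" .
    moreover have "card (neighbours G v - {v}) \<le> 1"
      using leaf card_mono[OF finite_neighbours[OF G], of "neighbours G v - {v}" v]
      by (simp add: degree_eq_card_neighbours)
    ultimately show thesis using leaf by (intro that[of "{v}"]) auto
  next
    case pair
    have key: "card (neighbours G a - {u, v}) \<le> 1 \<and> (\<Sum>x\<in>neighbours G a. degree G x) \<le> 5"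
      if ab: "adjacent G a b" "degree G a = 2" "degree G b = 2" "b \<in> {u, v}" for a b
    proof -
      have b: "b \<in> neighbours G a"
        using ab adjacent_in_vertices[OF G] by (auto simp: neighbours_def)
      have "card (neighbours G a) = 2" using ab by (simp add: degree_eq_card_neighbours)
      then have one: "card (neighbours G a - {b}) = 1" using b by simp
      have "card (neighbours G a - {u, v}) \<le> card (neighbours G a - {b})"
        using ab by (intro card_mono) (auto simp: finite_neighbours G)
      moreover have "(\<Sum>x\<in>neighbours G a. degree G x)
          = degree G b + (\<Sum>x\<in>neighbours G a - {b}. degree G x)"
        using b by (simp add: sum.remove finite_neighbours G)
      moreover have "(\<Sum>x\<in>neighbours G a - {b}. degree G x) \<le> card (neighbours G a - {b}) * 3"
        using sum_bounded_above[of "neighbours G a - {b}" "degree G" 3] le3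
        by (simp add: neighbours_def)
      ultimately show ?thesis using one ab by simp
    qed
    have "adjacent G v u" using pair adjacent_sym by metis
    then show thesis
      using pair key[of u v] key[of v u] adjacent_in_vertices[OF G pair(1)]
      by (intro that[of "{u, v}"]) auto
  qed
qed

section \<open>Greedy colouring\<close>

definition near :: "'a sgraph \<Rightarrow> 'a \<Rightarrow> 'a \<Rightarrow> bool" where
  "near G u v \<longleftrightarrow> u \<noteq> v \<and> (adjacent G u v \<or> (\<exists>x. adjacent G u x \<and> adjacent G x v))"

lemma near_sym: "near G u v \<Longrightarrow> near G v u"
  unfolding near_def by (blast intro: adjacent_sym)

lemma card_near_le:
  assumes G: "simple_graph G"
  shows "card {w \<in> A. near G v w} \<le> (\<Sum>x\<in>neighbours G v. degree G x)"
proof -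
  \<comment> \<open>A neighbour \<open>x\<close> accounts for itself and for its neighbours other than \<open>v\<close>. As \<open>v\<close> is one of
      its neighbours, these are at most as many as the degree of \<open>x\<close>.\<close>
  define N where "N x = insert x (neighbours G x - {v})" for x
  have fin: "finite (N x)" for x by (simp add: N_def finite_neighbours G)
  have "{w \<in> A. near G v w} \<subseteq> (\<Union>x\<in>neighbours G v. N x)"
    using adjacent_in_vertices[OF G] by (fastforce simp: near_def N_def neighbours_def)
  then have "card {w \<in> A. near G v w} \<le> card (\<Union>x\<in>neighbours G v. N x)"
    by (intro card_mono) (auto simp: fin finite_neighbours G)
  also have "\<dots> \<le> (\<Sum>x\<in>neighbours G v. card (N x))"
    by (intro card_UN_le finite_neighbours G)
  also have "\<dots> \<le> (\<Sum>x\<in>neighbours G v. degree G x)"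
  proof (rule sum_mono)
    fix x assume "x \<in> neighbours G v"
    then have "adjacent G x v" by (simp add: neighbours_def adjacent_sym)
    then have v: "v \<in> neighbours G x"
      using adjacent_in_vertices[OF G] by (simp add: neighbours_def)
    have "card (N x) \<le> Suc (card (neighbours G x - {v}))"
      by (simp add: N_def card_insert_if finite_neighbours G)
    also have "\<dots> = card (neighbours G x)"
      by (rule card.remove[OF finite_neighbours[OF G] v, symmetric])
    finally show "card (N x) \<le> degree G x" by (simp add: degree_eq_card_neighbours)
  qed
  finally show ?thesis .
qed

text \<open>The relation \<open>K\<close> stands for the edges of the cover. Keeping it separate from the graph allows
  the cover to stay the same while the induction passes to smaller graphs.\<close>

definition conflict_free ::
  "('a \<times> 'c \<Rightarrow> 'a \<times> 'c \<Rightarrow> bool) \<Rightarrow> ('a \<Rightarrow> 'c set) \<Rightarrow> 'a sgraph \<Rightarrow> 'a set \<Rightarrow> ('a \<Rightarrow> 'c) \<Rightarrow> bool"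
where
  "conflict_free K L G A f \<longleftrightarrow>
     (\<forall>u\<in>A. f u \<in> L u) \<and> (\<forall>u\<in>A. \<forall>v\<in>A. near G u v \<longrightarrow> \<not> K (u, f u) (v, f v))"

lemma conflict_free_insert:
  assumes sym: "\<And>x y. K x y \<Longrightarrow> K y x"
    and match: "\<And>u a c d. u \<in> A \<Longrightarrow> a \<in> L u \<Longrightarrow> c \<in> L v \<Longrightarrow> d \<in> L v \<Longrightarrow>
        K (u, a) (v, c) \<Longrightarrow> K (u, a) (v, d) \<Longrightarrow> c = d"
    and A: "finite A" "v \<notin> A"
    and few: "card {w \<in> A. near G v w} < card (L v)"
    and f: "conflict_free K L G A f"
  shows "\<exists>c. conflict_free K L G (insert v A) (f(v := c))"
proof -
  define B where "B w = {c \<in> L v. K (w, f w) (v, c)}" for w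
  have B: "card (B w) \<le> 1 \<and> finite (B w)" if "w \<in> A" for w
  proof -
    have "f w \<in> L w" using f that by (simp add: conflict_free_def)
    then have "c = d" if "c \<in> B w" "d \<in> B w" for c d
      using match[OF \<open>w \<in> A\<close>] that by (simp add: B_def)
    then obtain c where "B w \<subseteq> {c}" by blast
    then show ?thesis by (auto dest!: subset_singletonD)
  qed
  have "card (\<Union>w\<in>{w \<in> A. near G v w}. B w) \<le> (\<Sum>w\<in>{w \<in> A. near G v w}. card (B w))"
    using A by (intro card_UN_le) simp
  also have "\<dots> \<le> card {w \<in> A. near G v w} * 1"
    using sum_bounded_above[of "{w \<in> A. near G v w}" "\<lambda>w. card (B w)" 1] B by simp
  finally have "card (\<Union>w\<in>{w \<in> A. near G v w}. B w) < card (L v)"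
    using few by simp
  moreover have "finite (\<Union>w\<in>{w \<in> A. near G v w}. B w)" using A B by simp
  ultimately have "\<not> L v \<subseteq> (\<Union>w\<in>{w \<in> A. near G v w}. B w)"
    using card_mono not_less by blast
  then obtain c where c: "c \<in> L v" "\<And>w. w \<in> A \<Longrightarrow> near G v w \<Longrightarrow> \<not> K (w, f w) (v, c)"
    unfolding B_def by blast
  have "conflict_free K L G (insert v A) (f(v := c))"
    unfolding conflict_free_def
  proof (intro conjI ballI impI)
    fix u assume "u \<in> insert v A"
    then show "(f(v := c)) u \<in> L u" using f c(1) by (auto simp: conflict_free_def)
  next
    fix u w assume u: "u \<in> insert v A" and w: "w \<in> insert v A" and near: "near G u w"
    have "u \<noteq> w" using near by (simp add: near_def)
    then consider "u = v" "w \<in> A" "w \<noteq> v" | "w = v" "u \<in> A" "u \<noteq> v"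
      | "u \<in> A" "w \<in> A" "u \<noteq> v" "w \<noteq> v"
      using u w A by blast
    then show "\<not> K (u, (f(v := c)) u) (w, (f(v := c)) w)"
    proof cases
      case 1
      then show ?thesis using c(2)[of w] near sym[of "(v, c)" "(w, f w)"] by auto
    next
      case 2
      then show ?thesis using c(2)[of u] near near_sym[OF near] by simp
    next
      case 3
      then show ?thesis using f near by (simp add: conflict_free_def)
    qed
  qed
  then show ?thesis ..
qed

definition delete_vertices :: "'a sgraph \<Rightarrow> 'a set \<Rightarrow> 'a sgraph" where
  "delete_vertices G S =
     \<lparr>vertices = vertices G - S, edges = {e \<in> edges G. e \<inter> S = {}}\<rparr>"

lemma adjacent_delete_vertices:
  "adjacent (delete_vertices G S) u v \<longleftrightarrow> adjacent G u v \<and> u \<notin> S \<and> v \<notin> S"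
  by (auto simp: adjacent_def delete_vertices_def)

lemma subgraph_delete_vertices: "simple_graph G \<Longrightarrow> subgraph (delete_vertices G S) G"
  by (auto simp: subgraph_def simple_graph_def delete_vertices_def)

text \<open>A path of length 2 through \<open>x \<in> S\<close> with both ends outside \<open>S\<close> would use two neighbours of \<open>x\<close>
  outside \<open>S\<close>.\<close>

lemma near_delete_vertices:
  assumes G: "simple_graph G" and S: "\<And>v. v \<in> S \<Longrightarrow> card (neighbours G v - S) \<le> 1"
    and uv: "u \<notin> S" "v \<notin> S" "near G u v"
  shows "near (delete_vertices G S) u v"
proof -
  have "x \<notin> S" if x: "adjacent G u x" "adjacent G x v" for x
  proof
    assume "x \<in> S"
    have "{u, v} \<subseteq> neighbours G x - S"
      using x uv adjacent_in_vertices[OF G] by (simp add: neighbours_def adjacent_sym)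
    then have "card {u, v} \<le> card (neighbours G x - S)"
      by (intro card_mono) (auto simp: finite_neighbours G)
    then show False using S[OF \<open>x \<in> S\<close>] uv by (simp add: near_def)
  qed
  then show ?thesis using uv by (auto simp: near_def adjacent_delete_vertices)
qed

text \<open>A colouring of the graph without a reducible set \<open>S\<close> extends to \<open>S\<close> one vertex at a time, in
  any order: each vertex of \<open>S\<close> has at most 5 vertices near it in the whole graph, whether
  these are coloured already or not.\<close>

lemma conflict_free_colouring:
  assumes sym: "\<And>x y. K x y \<Longrightarrow> K y x"
    and "simple_graph G" "subcubic G" "mad G < 12 / 5"
    and "\<And>v. v \<in> vertices G \<Longrightarrow> card (L v) \<ge> 6"
    and "\<And>u v a c d. u \<in> vertices G \<Longrightarrow> v \<in> vertices G \<Longrightarrow> u \<noteq> v \<Longrightarrow>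
        a \<in> L u \<Longrightarrow> c \<in> L v \<Longrightarrow> d \<in> L v \<Longrightarrow>
        K (u, a) (v, c) \<Longrightarrow> K (u, a) (v, d) \<Longrightarrow> c = d"
  shows "\<exists>f. conflict_free K L G (vertices G) f"
  using assms(2-)
proof (induction "card (vertices G)" arbitrary: G rule: less_induct)
  case less
  note G = less.prems(1) and cubic = less.prems(2) and mad = less.prems(3)
    and lists = less.prems(4) and match = less.prems(5)
  have finV: "finite (vertices G)" using G by (simp add: simple_graph_def)
  show ?case
  proof (cases "vertices G = {}")
    case True
    then have "conflict_free K L G (vertices G) f" for f by (simp add: conflict_free_def)
    then show ?thesis by blast
  next
    case False
    then obtain S where S: "S \<subseteq> vertices G" "S \<noteq> {}"
      and out: "\<And>v. v \<in> S \<Longrightarrow> card (neighbours G v - S) \<le> 1"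
      and few: "\<And>v. v \<in> S \<Longrightarrow> (\<Sum>x\<in>neighbours G v. degree G x) \<le> 5"
      using exists_reducible_set[OF G _ cubic mad] by metis
    define H where "H = delete_vertices G S"
    have HG: "subgraph H G" unfolding H_def by (rule subgraph_delete_vertices[OF G])
    then have H: "simple_graph H" by (simp add: subgraph_def)
    have VH: "vertices H = vertices G - S" by (simp add: H_def delete_vertices_def)
    have "\<exists>f. conflict_free K L H (vertices H) f"
    proof (rule less.hyps)
      show "card (vertices H) < card (vertices G)"
        using S finV by (intro psubset_card_mono) (auto simp: VH)
      show "subcubic H"
        unfolding subcubic_iff[OF H]
      proof
        fix v assume "v \<in> vertices H"
        then show "degree H v \<le> 3"
          using cubic degree_subgraph_le[OF G HG, of v] by (force simp: subcubic_iff G VH)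
      qed
      show "mad H < 12 / 5"
        using mad mad_subgraph_mono[OF G HG] by linarith
      show "6 \<le> card (L v)" if "v \<in> vertices H" for v
        using lists that by (simp add: VH)
      show "c = d" if "u \<in> vertices H" "v \<in> vertices H" "u \<noteq> v" "a \<in> L u" "c \<in> L v" "d \<in> L v"
        "K (u, a) (v, c)" "K (u, a) (v, d)" for u v a c d
        using match[of u v a c d] that by (simp add: VH)
    qed (fact H)
    then obtain f0 where "conflict_free K L H (vertices H) f0" ..
    moreover have "near H u v" if "u \<in> vertices G - S" "v \<in> vertices G - S" "near G u v" for u v
      unfolding H_def by (rule near_delete_vertices[OF G out]) (use that in simp_all)
    ultimately have f0: "conflict_free K L G (vertices G - S) f0"
      unfolding conflict_free_def VH by blast
    \<comment> \<open>The vertices of \<open>T\<close> are those members of \<open>S\<close> that have a colour so far.\<close>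
    have "\<exists>f. conflict_free K L G (vertices G - S \<union> T) f" if "T \<subseteq> S" for T
    proof -
      have "finite T" using that S finV by (meson finite_subset)
      then show ?thesis using that
      proof (induction T rule: finite_induct)
        case empty
        then show ?case using f0 by auto
      next
        case (insert v T)
        then obtain f where f: "conflict_free K L G (vertices G - S \<union> T) f" by auto
        have v: "v \<in> S" "v \<notin> vertices G - S \<union> T" using insert by auto
        have "card {w \<in> vertices G - S \<union> T. near G v w} < card (L v)"
        proof -
          have "6 \<le> card (L v)" using lists v(1) S by blast
          then show ?thesis
            using card_near_le[OF G, of "vertices G - S \<union> T" v] few[OF v(1)] by linarith
        qed
        moreover have "finite (vertices G - S \<union> T)" using finV insert.hyps by simp
        moreover have "c = d" if "u \<in> vertices G - S \<union> T" "a \<in> L u" "c \<in> L v" "d \<in> L v"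
          "K (u, a) (v, c)" "K (u, a) (v, d)" for u a c d
        proof (rule match)
          show "u \<in> vertices G" "v \<in> vertices G" "u \<noteq> v"
            using that(1) v S insert.prems by auto
        qed (fact that)+
        ultimately have "\<exists>c. conflict_free K L G (insert v (vertices G - S \<union> T)) (f(v := c))"
          by (intro conflict_free_insert[OF sym _ _ v(2) _ f])
        then show ?case by (auto simp only: Un_insert_right)
      qed
    qed
    from this[of S] S show ?thesis by (simp add: Un_absorb2)
  qed
qed

section \<open>Covers of the square\<close>

lemma distance_2_common_neighbour:
  assumes "distance G u v = 2"
  obtains x where "adjacent G u x" "adjacent G x v"
proof -
  let ?D = "(\<lambda>p. enat (length p - 1)) ` {p. walk G u p v}"
  have inf: "Inf ?D = 2" using assms by (simp add: distance_def)
  then have "?D \<noteq> {}" unfolding Inf_enat_def by (metis enat.distinct(1) numeral_eq_enat)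
  \<comment> \<open>The infimum of a nonempty set of extended naturals is attained.\<close>
  then have "Inf ?D \<in> ?D"
    unfolding Inf_enat_def by (metis (mono_tags, lifting) LeastI ex_in_conv)
  then have "2 \<in> ?D" by (simp only: inf)
  then obtain p where p: "walk G u p v" "length p - 1 = 2"
    by (auto simp: numeral_eq_enat)
  then obtain a x b where "p = [a, x, b]"
    by (auto simp: numeral_eq_Suc length_Suc_conv walk_def neq_Nil_conv)
  then show thesis using p that by (auto simp: walk_def)
qed

lemma adjacent_square_imp_near:
  assumes "adjacent (square G) u v" "u \<noteq> v"
  shows "near G u v"
proof (cases "adjacent G u v")
  case False
  then obtain a b where ab: "{u, v} = {a, b}" "distance G a b = 2"
    using assms by (auto simp: adjacent_def square_def)
  obtain x where "adjacent G a x" "adjacent G x b"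
    using distance_2_common_neighbour[OF ab(2)] .
  moreover have "a \<noteq> b" using ab(1) assms(2) by auto
  ultimately have "near G a b" by (auto simp: near_def)
  then have "near G a b" "near G b a" by (simp_all add: near_sym)
  then show ?thesis using ab(1) by (auto simp: doubleton_eq_iff)
qed (use assms in \<open>simp add: near_def\<close>)

lemma cover_adjacent_imp_adjacent:
  assumes "cover G L H" "u \<in> vertices G" "v \<in> vertices G" "u \<noteq> v" "a \<in> L u" "c \<in> L v"
    and "adjacent H (u, a) (v, c)"
  shows "adjacent G u v"
proof (rule ccontr)
  assume "\<not> adjacent G u v"
  then have "edges_between H ({u} \<times> L u) ({v} \<times> L v) = {}"
    using assms(1-4) unfolding cover_def by metis
  moreover have "{(u, a), (v, c)} \<in> edges_between H ({u} \<times> L u) ({v} \<times> L v)"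
    using assms(5-7) unfolding edges_between_def adjacent_def by blast
  ultimately show False by blast
qed

lemma cover_unique_conflict:
  assumes cov: "cover G L H" and uv: "u \<in> vertices G" "v \<in> vertices G" "u \<noteq> v"
    and col: "a \<in> L u" "c \<in> L v" "d \<in> L v"
    and adj: "adjacent H (u, a) (v, c)" "adjacent H (u, a) (v, d)"
  shows "c = d"
proof -
  have "adjacent G u v" using cover_adjacent_imp_adjacent[OF cov uv col(1,2) adj(1)] .
  then have "matching (edges_between H ({u} \<times> L u) ({v} \<times> L v))"
    using cov uv unfolding cover_def by metis
  moreover have "{(u, a), (v, c)} \<in> edges_between H ({u} \<times> L u) ({v} \<times> L v)"
    using col(1,2) adj(1) unfolding edges_between_def adjacent_def by blast
  moreover have "{(u, a), (v, d)} \<in> edges_between H ({u} \<times> L u) ({v} \<times> L v)"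
    using col(1,3) adj(2) unfolding edges_between_def adjacent_def by blast
  moreover have "{(u, a), (v, c)} \<inter> {(u, a), (v, d)} \<noteq> {}" by simp
  ultimately have "{(u, a), (v, c)} = {(u, a), (v, d)}"
    unfolding matching_def by metis
  then show ?thesis using uv(3) by (simp add: doubleton_eq_iff)
qed

lemma DP_colorable_square:
  assumes G: "simple_graph G" and "subcubic G" "mad G < 12 / 5"
  shows "DP_colorable 6 (square G)"
  unfolding DP_colorable_def
proof (intro allI impI, elim conjE)
  fix L :: "'a \<Rightarrow> nat set" and H
  assume lists: "\<forall>u\<in>vertices (square G). 6 \<le> card (L u)" and cov: "cover (square G) L H"
  have V: "vertices (square G) = vertices G" by (simp add: square_def)
  have H: "simple_graph H" and VH: "vertices H = (SIGMA u:vertices G. L u)"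
    using cov by (simp_all add: cover_def V)
  have "\<exists>f. conflict_free (adjacent H) L G (vertices G) f"
  proof (rule conflict_free_colouring)
    show "adjacent H y x" if "adjacent H x y" for x y
      using that by (rule adjacent_sym)
    show "6 \<le> card (L v)" if "v \<in> vertices G" for v
      using lists that by (simp add: V)
    show "c = d" if "u \<in> vertices G" "v \<in> vertices G" "u \<noteq> v" "a \<in> L u" "c \<in> L v" "d \<in> L v"
      "adjacent H (u, a) (v, c)" "adjacent H (u, a) (v, d)" for u v a c d
      by (rule cover_unique_conflict[OF cov _ _ that(3-8)]) (simp_all add: V that(1,2))
  qed fact+
  then obtain f where f: "conflict_free (adjacent H) L G (vertices G) f" ..
  define I where "I = (\<lambda>v. (v, f v)) ` vertices G"
  have "\<not> adjacent H (u, f u) (v, f v)" if uv: "u \<in> vertices G" "v \<in> vertices G" for u v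
  proof
    assume adj: "adjacent H (u, f u) (v, f v)"
    have "u \<noteq> v" using adjacent_in_vertices(3)[OF H adj] by auto
    moreover have "f u \<in> L u" "f v \<in> L v" using f uv by (simp_all add: conflict_free_def)
    ultimately have "adjacent (square G) u v"
      using cover_adjacent_imp_adjacent[OF cov _ _ _ _ _ adj] uv by (simp add: V)
    then show False
      using adjacent_square_imp_near[OF _ \<open>u \<noteq> v\<close>] f uv adj by (simp add: conflict_free_def)
  qed
  then have "independent_set H I"
    using f by (auto simp: independent_set_def I_def VH conflict_free_def)
  moreover have "card I = card (vertices (square G))"
    unfolding I_def V by (rule card_image) (simp add: inj_on_def)
  ultimately show "\<exists>I. independent_set H I \<and> card I = card (vertices (square G))" by blast
qed

theorem theorem2:
  fixes G :: "'a sgraph"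
  assumes "simple_graph G"
    and "subcubic G"
    and "mad G < 12 / 5"
  shows "DP_chromatic_number (square G) \<le> 6"
  unfolding DP_chromatic_number_def by (rule Least_le) (rule DP_colorable_square[OF assms])

end
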